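(* Let $\Sigma$ be a finite alphabet and let $\rho\in(0,1)$. Let $P,Q\in\Sigma^*$ be strings of lengths $m$ and $n$ respectively, and let $a,b\in\Sigma$ be arbitrary. Then $$d_\rho(PaQ,PQ)\le \frac{\pi\sqrt2}{\sqrt{L}}\,A_{M}(\rho)+\frac{\pi}{2}\cdot\frac{\rho^{K+1}}{1-\rho}+\frac{\pi}{2}\rho^{L+1}$$ and $$d_\rho(PaQ,PbQ)\le \frac{\pi}{\sqrt{L}}\,A_{M}(\rho)+\frac{\pi}{2}\cdot\frac{\rho^{K+1}}{1-\rho},$$ where $L=m+n$, $K=\lfloor L/2\rfloor$, $M=\min(m+1,n+1)$, and $$A_M(\rho)=\sum_{k=1}^\infty\rho^k\min(k,M)=\frac{\rho\bigl(1-(M+1)\rho^M+M\rho^{M+1}\bigr)}{(1-\rho)^2}+\frac{M\rho^{M+1}}{1-\rho}.$$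
   Context: $\Sigma$ is a finite set of characters; $\Sigma^k$ is the set of strings of length $k$ over $\Sigma$, and $\Sigma^*=\bigsqcup_{k\ge 0}\Sigma^k$; juxtaposition denotes concatenation and $|S|$ denotes the length of $S$. For strings $S,X$, the multiplicity $c(S,X)$ is the number of pairs $(P_1,P_2)$ of strings with $S=P_1XP_2$. For $k\ge 1$, $[S]_k\in\mathbb{R}^{\Sigma^k}$ is the $k$-gram count vector $[S]_k(X)=c(S,X)$ for $X\in\Sigma^k$. For vectors $u,v$ with nonnegative entries, $\theta(u,v)=\arccos\left(\frac{u\cdot v}{\|u\|\|v\|}\right)$ if $u,v\ne 0$, $\theta(u,v)=0$ if $u=v=0$, and $\theta(u,v)=\pi/2$ if exactly one of $u,v$ is $0$. Set $\theta_k(S,T)=\theta([S]_k,[T]_k)$ and $d_\rho(S,T)=\sum_{k\ge 1}\rho^k\theta_k(S,T)$. *)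

theory Defs
  imports "HOL-Analysis.Analysis"
begin

definition words :: "'a set \<Rightarrow> nat \<Rightarrow> 'a list set" where
  "words \<Sigma> k = {X. set X \<subseteq> \<Sigma> \<and> length X = k}"

definition multiplicity :: "'a list \<Rightarrow> 'a list \<Rightarrow> nat" where
  "multiplicity S X = card {(P1, P2). S = P1 @ X @ P2}"

definition gram_vec :: "'a set \<Rightarrow> nat \<Rightarrow> 'a list \<Rightarrow> 'a list \<Rightarrow> real" where
  "gram_vec \<Sigma> k S = (\<lambda>X\<in>words \<Sigma> k. real (multiplicity S X))"

text \<open>Vectors with coordinates indexed by a finite set \<open>I\<close> are functions of which only the
  values on \<open>I\<close> matter; \<open>L2_set u I\<close> is the Euclidean norm.\<close>

definition vec_zero :: "'i set \<Rightarrow> ('i \<Rightarrow> real) \<Rightarrow> bool" where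
  "vec_zero I u \<longleftrightarrow> (\<forall>i\<in>I. u i = 0)"

definition vec_angle :: "'i set \<Rightarrow> ('i \<Rightarrow> real) \<Rightarrow> ('i \<Rightarrow> real) \<Rightarrow> real" where
  "vec_angle I u v =
     (if vec_zero I u \<and> vec_zero I v then 0
      else if vec_zero I u \<or> vec_zero I v then pi / 2
      else arccos ((\<Sum>i\<in>I. u i * v i) / (L2_set u I * L2_set v I)))"

definition gram_angle :: "'a set \<Rightarrow> nat \<Rightarrow> 'a list \<Rightarrow> 'a list \<Rightarrow> real" where
  "gram_angle \<Sigma> k S T = vec_angle (words \<Sigma> k) (gram_vec \<Sigma> k S) (gram_vec \<Sigma> k T)"

text \<open>The series run over \<open>k \<ge> 1\<close>, hence the shift by \<open>Suc\<close>.\<close>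

definition gram_dist :: "'a set \<Rightarrow> real \<Rightarrow> 'a list \<Rightarrow> 'a list \<Rightarrow> real" where
  "gram_dist \<Sigma> \<rho> S T = (\<Sum>k. \<rho> ^ Suc k * gram_angle \<Sigma> (Suc k) S T)"

definition A_series :: "nat \<Rightarrow> real \<Rightarrow> real" where
  "A_series M \<rho> = (\<Sum>k. \<rho> ^ Suc k * real (min (Suc k) M))"

text \<open>Both series converge, so \<open>suminf\<close> denotes their actual sums.\<close>

lemma gram_angle_eq_0:
  assumes "length S < k" "length T < k"
  shows "gram_angle \<Sigma> k S T = 0"
proof -
  have "vec_zero (words \<Sigma> k) (gram_vec \<Sigma> k U)" if "length U < k" for U :: "'a list"
  proof -
    have "{(P1, P2). U = P1 @ X @ P2} = {}" if "X \<in> words \<Sigma> k" for X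
      using that \<open>length U < k\<close> by (auto simp: words_def)
    then show ?thesis
      by (simp add: vec_zero_def gram_vec_def multiplicity_def)
  qed
  then show ?thesis
    using assms by (simp add: gram_angle_def vec_angle_def)
qed

lemma summable_gram_dist: "summable (\<lambda>k. \<rho> ^ Suc k * gram_angle \<Sigma> (Suc k) S T)"
  by (rule summable_finite[of "{..<max (length S) (length T)}"])
     (auto simp: gram_angle_eq_0)

lemma summable_A_series:
  assumes "0 < \<rho>" "\<rho> < 1"
  shows "summable (\<lambda>k. \<rho> ^ Suc k * real (min (Suc k) M))"
proof (rule summable_comparison_test')
  show "summable (\<lambda>k. \<rho> ^ Suc k * real M)"
    using assms by (intro summable_mult2 summable_Suc_iff[THEN iffD2] summable_geometric) auto
  show "norm (\<rho> ^ Suc k * real (min (Suc k) M)) \<le> \<rho> ^ Suc k * real M" for k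
  proof -
    have "\<rho> ^ Suc k * real (min (Suc k) M) \<le> \<rho> ^ Suc k * real M"
      using assms by (intro mult_left_mono) auto
    then show ?thesis
      using assms by (simp add: abs_mult)
  qed
qed

end

theory Submission
  imports Defs
begin

text \<open>
  Cut \<open>P @ C @ Q\<close> at the inserted block \<open>C\<close>. A window of length \<open>k\<close> that lies inside \<open>P\<close> or inside
  \<open>Q\<close> survives every replacement of \<open>C\<close>, so the count vectors \<open>u\<close> of \<open>P @ C @ Q\<close> and \<open>v\<close> of
  \<open>P @ D @ Q\<close> share the nonnegative part \<open>w = [P]\<^sub>k + [Q]\<^sub>k\<close>
  (\<open>multiplicity_append_superadditive\<close>). The entries of a count vector sum to the number of windows
  (\<open>sum_multiplicity_words\<close>), and comparing these numbers shows that for blocks of length at most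
  one the remainders \<open>u - w\<close> and \<open>v - w\<close> have total mass at most \<open>min k M\<close>. Hence
  \<open>\<parallel>u - v\<parallel> \<le> \<surd>2 \<cdot> min k M\<close>.

  On the other hand \<open>u\<close> has integer entries, so \<open>\<parallel>u\<parallel>\<^sup>2\<close> is at least the number of windows, which for
  \<open>k \<le> K\<close> is at least \<open>L / 2\<close>. The angle between nonnegative vectors satisfies
  \<open>sin \<theta> \<le> \<parallel>u - v\<parallel> / \<parallel>u\<parallel>\<close> and lies in \<open>[0, \<pi>/2]\<close>, where \<open>\<theta> \<le> \<pi>/2 \<cdot> sin \<theta>\<close> by concavity of the sine
  (\<open>vec_angle_le_relative_error\<close>). Together these give \<open>\<theta>\<^sub>k \<le> \<pi> min k M / \<surd>L\<close> for \<open>k \<le> K\<close>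
  (\<open>gram_angle_replace_le\<close>). For \<open>k > K\<close> the bound \<open>\<theta>\<^sub>k \<le> \<pi>/2\<close> leaves a geometric tail.

  The argument treats insertion (\<open>D\<close> empty) and substitution (\<open>D\<close> a single letter) alike, so both
  estimates follow from one bound, \<open>gram_dist_replace_le\<close>. The closed form of \<open>A_series\<close> comes from
  reading \<open>min k M\<close> as a sum of \<open>M\<close> step functions, each contributing a geometric tail.
\<close>

section \<open>Angles between nonnegative vectors\<close>

text \<open>Jordan's inequality: on \<open>[0, \<pi>/2]\<close> the concave sine lies above its chord.\<close>

lemma le_half_pi_mult_sin:
  fixes x :: real
  assumes "0 \<le> x" "x \<le> pi / 2"
  shows "x \<le> pi / 2 * sin x"
proof -
  have "concave_on {0..pi/2} (sin :: real \<Rightarrow> real)"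
    by (rule f''_le0_imp_concave[where f' = cos and f'' = "\<lambda>x. - sin x"])
       (auto intro!: derivative_eq_intros sin_ge_zero)
  then have "sin ((1 - 2 * x / pi) *\<^sub>R 0 + (2 * x / pi) *\<^sub>R (pi / 2))
               \<ge> (1 - 2 * x / pi) * sin 0 + (2 * x / pi) * sin (pi / 2)"
    using assms by (intro concave_onD) (auto simp: field_simps)
  then show ?thesis
    by (simp add: field_simps)
qed

lemma L2_set_power2: "(L2_set u I)\<^sup>2 = (\<Sum>i\<in>I. (u i)\<^sup>2)"
  by (simp add: L2_set_def sum_nonneg)

lemma L2_set_diff_power2:
  "(L2_set (\<lambda>i. u i - v i) I)\<^sup>2 = (L2_set u I)\<^sup>2 + (L2_set v I)\<^sup>2 - 2 * (\<Sum>i\<in>I. u i * v i)"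
  unfolding L2_set_power2
  by (simp add: power2_diff sum.distrib sum_subtractf sum_distrib_left mult.assoc)

lemma cos_vec_angle_bounds:
  assumes "\<And>i. i \<in> I \<Longrightarrow> 0 \<le> u i" "\<And>i. i \<in> I \<Longrightarrow> 0 \<le> v i"
  shows "0 \<le> (\<Sum>i\<in>I. u i * v i) / (L2_set u I * L2_set v I)"
    and "(\<Sum>i\<in>I. u i * v i) / (L2_set u I * L2_set v I) \<le> 1"
proof -
  show "0 \<le> (\<Sum>i\<in>I. u i * v i) / (L2_set u I * L2_set v I)"
    using assms by (intro divide_nonneg_nonneg sum_nonneg mult_nonneg_nonneg) auto
  have "(\<Sum>i\<in>I. u i * v i) \<le> (\<Sum>i\<in>I. \<bar>u i\<bar> * \<bar>v i\<bar>)"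
    using assms by (intro sum_mono) auto
  also have "\<dots> \<le> L2_set u I * L2_set v I"
    by (rule L2_set_mult_ineq)
  finally have "(\<Sum>i\<in>I. u i * v i) / (L2_set u I * L2_set v I)
                  \<le> (L2_set u I * L2_set v I) / (L2_set u I * L2_set v I)"
    by (rule divide_right_mono) simp
  also have "\<dots> \<le> 1"
    by simp
  finally show "(\<Sum>i\<in>I. u i * v i) / (L2_set u I * L2_set v I) \<le> 1" .
qed

lemma vec_angle_le_half_pi:
  assumes "\<And>i. i \<in> I \<Longrightarrow> 0 \<le> u i" "\<And>i. i \<in> I \<Longrightarrow> 0 \<le> v i"
  shows "vec_angle I u v \<le> pi / 2"
  using arccos_le_pi2 cos_vec_angle_bounds[of I u v, OF assms] by (simp add: vec_angle_def)

text \<open>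
  With \<open>c = cos \<theta>\<close>, the distance from \<open>u\<close> to the line spanned by \<open>v\<close> is \<open>\<parallel>u\<parallel> sin \<theta>\<close> and is at most
  \<open>\<parallel>u - v\<parallel>\<close>; algebraically, \<open>\<parallel>u - v\<parallel>\<^sup>2 - \<parallel>u\<parallel>\<^sup>2 (1 - c\<^sup>2) = (\<parallel>v\<parallel> - c \<parallel>u\<parallel>)\<^sup>2\<close>. Jordan's inequality turns
  this bound on the sine into one on the angle. If \<open>v = 0\<close>, both sides equal \<open>\<pi>/2\<close>.
\<close>

lemma vec_angle_le_relative_error:
  assumes "finite I"
    and nonneg: "\<And>i. i \<in> I \<Longrightarrow> 0 \<le> u i" "\<And>i. i \<in> I \<Longrightarrow> 0 \<le> v i"
    and "\<not> vec_zero I u"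
  shows "vec_angle I u v \<le> pi / 2 * (L2_set (\<lambda>i. u i - v i) I / L2_set u I)"
proof -
  define U V D where "U = L2_set u I" and "V = L2_set v I" and "D = L2_set (\<lambda>i. u i - v i) I"
  have U: "U > 0"
    using assms by (auto simp: U_def vec_zero_def order.strict_iff_order L2_set_eq_0_iff)
  show ?thesis
  proof (cases "vec_zero I v")
    case True
    then have "D = U"
      unfolding D_def U_def by (intro L2_set_cong) (auto simp: vec_zero_def)
    then show ?thesis
      using U True assms by (simp add: vec_angle_def D_def U_def)
  next
    case False
    define c where "c = (\<Sum>i\<in>I. u i * v i) / (U * V)"
    have V: "V > 0"
      using False assms by (auto simp: V_def vec_zero_def order.strict_iff_order L2_set_eq_0_iff)
    have c: "0 \<le> c" "c \<le> 1"
      using cos_vec_angle_bounds[of I u v, OF nonneg] by (auto simp: c_def U_def V_def)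
    have angle: "vec_angle I u v = arccos c"
      using False assms by (simp add: vec_angle_def c_def U_def V_def)
    have "D\<^sup>2 = U\<^sup>2 + V\<^sup>2 - 2 * (\<Sum>i\<in>I. u i * v i)"
      unfolding D_def U_def V_def by (rule L2_set_diff_power2)
    also have "(\<Sum>i\<in>I. u i * v i) = c * U * V"
      using U V by (simp add: c_def)
    also have "U\<^sup>2 + V\<^sup>2 - 2 * (c * U * V) = U\<^sup>2 * (1 - c\<^sup>2) + (V - c * U)\<^sup>2"
      by (simp add: power2_eq_square algebra_simps)
    finally have "1 - c\<^sup>2 \<le> (D / U)\<^sup>2"
      using U by (simp add: power_divide field_simps)
    then have "sin (arccos c) \<le> D / U"
      using c U by (auto simp: sin_arccos D_def intro!: real_le_lsqrt)
    then have "pi / 2 * sin (arccos c) \<le> pi / 2 * (D / U)"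
      by (intro mult_left_mono) auto
    moreover have "arccos c \<le> pi / 2 * sin (arccos c)"
      using c by (intro le_half_pi_mult_sin arccos_lbound arccos_le_pi2) auto
    ultimately show ?thesis
      using angle by (simp add: D_def U_def)
  qed
qed

text \<open>Two nonnegative remainders never add up coordinatewise: \<open>(x - y)\<^sup>2 \<le> x\<^sup>2 + y\<^sup>2\<close> for
  \<open>x, y \<ge> 0\<close>, which gives \<open>\<surd>2\<close> where the triangle inequality would give \<open>2\<close>.\<close>

lemma L2_set_diff_le_common_part:
  assumes w: "\<And>i. i \<in> I \<Longrightarrow> w i \<le> u i" "\<And>i. i \<in> I \<Longrightarrow> w i \<le> v i"
    and t: "(\<Sum>i\<in>I. u i - w i) \<le> t" "(\<Sum>i\<in>I. v i - w i) \<le> t"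
  shows "L2_set (\<lambda>i. u i - v i) I \<le> sqrt 2 * t"
proof -
  have remainder: "(L2_set (\<lambda>i. z i - w i) I)\<^sup>2 \<le> t\<^sup>2"
    if "\<And>i. i \<in> I \<Longrightarrow> w i \<le> z i" "(\<Sum>i\<in>I. z i - w i) \<le> t" for z
  proof (rule power_mono)
    show "L2_set (\<lambda>i. z i - w i) I \<le> t"
      using L2_set_le_sum[of I "\<lambda>i. z i - w i"] that by force
  qed simp
  have "(u i - v i)\<^sup>2 \<le> (u i - w i)\<^sup>2 + (v i - w i)\<^sup>2" if "i \<in> I" for i
  proof -
    have "0 \<le> 2 * ((u i - w i) * (v i - w i))"
      using w[OF that] by simp
    then show ?thesis
      by (simp add: power2_eq_square algebra_simps)
  qed
  then have "(L2_set (\<lambda>i. u i - v i) I)\<^sup>2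
               \<le> (L2_set (\<lambda>i. u i - w i) I)\<^sup>2 + (L2_set (\<lambda>i. v i - w i) I)\<^sup>2"
    unfolding L2_set_power2 sum.distrib[symmetric] by (rule sum_mono)
  also have "\<dots> \<le> t\<^sup>2 + t\<^sup>2"
    using remainder[OF w(1) t(1)] remainder[OF w(2) t(2)] by (intro add_mono) auto
  also have "\<dots> = (sqrt 2 * t)\<^sup>2"
    by (simp add: power_mult_distrib)
  finally show ?thesis
  proof (rule power2_le_imp_le)
    have "0 \<le> (\<Sum>i\<in>I. u i - w i)"
      using w by (intro sum_nonneg) simp
    then show "0 \<le> sqrt 2 * t"
      using t by simp
  qed
qed

section \<open>Counting windows\<close>

lemma finite_occurrences: "finite {(P1, P2). S = P1 @ X @ P2}"
proof (rule finite_subset)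
  show "{(P1, P2). S = P1 @ X @ P2} \<subseteq> (\<lambda>i. (take i S, drop (i + length X) S)) ` {..length S}"
  proof (rule subsetI)
    fix p assume "p \<in> {(P1, P2). S = P1 @ X @ P2}"
    then show "p \<in> (\<lambda>i. (take i S, drop (i + length X) S)) ` {..length S}"
      by (intro image_eqI[of _ _ "length (fst p)"]) auto
  qed
qed simp

text \<open>An occurrence in \<open>S\<close> of a word of length \<open>k\<close> is determined by the position where its window
  starts, and every position with room for \<open>k\<close> letters arises.\<close>

lemma sum_multiplicity_words:
  assumes "finite \<Sigma>" "S \<in> lists \<Sigma>"
  shows "(\<Sum>X\<in>words \<Sigma> k. multiplicity S X) = length S + 1 - k"
proof -
  let ?occ = "SIGMA X:words \<Sigma> k. {(P1, P2). S = P1 @ X @ P2}"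
  have fin: "finite (words \<Sigma> k)"
    unfolding words_def by (rule finite_lists_length_eq[OF assms(1)])
  have "(\<Sum>X\<in>words \<Sigma> k. multiplicity S X) = card ?occ"
    unfolding multiplicity_def by (intro card_SigmaI[symmetric] fin ballI finite_occurrences)
  also have "bij_betw (\<lambda>(X, P1, P2). length P1) ?occ {i. i + k \<le> length S}"
  proof (rule bij_betw_byWitness[where f' = "\<lambda>i. (take k (drop i S), take i S, drop (i + k) S)"])
    show "(\<lambda>i. (take k (drop i S), take i S, drop (i + k) S)) ` {i. i + k \<le> length S} \<subseteq> ?occ"
    proof clarsimp
      fix i assume i: "i + k \<le> length S"
      have "take k (drop i S) @ drop (i + k) S = drop i S"
        by (metis add.commute append_take_drop_id drop_drop)
      moreover have "set (take k (drop i S)) \<subseteq> \<Sigma>"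
        using assms(2) by (auto dest!: in_set_takeD in_set_dropD)
      ultimately show "take k (drop i S) \<in> words \<Sigma> k
                        \<and> S = take i S @ take k (drop i S) @ drop (i + k) S"
        using i by (simp add: words_def)
    qed
  qed (auto simp: words_def)
  then have "card ?occ = card {i. i + k \<le> length S}"
    by (rule bij_betw_same_card)
  also have "{i. i + k \<le> length S} = {..<length S + 1 - k}"
    by auto
  finally show ?thesis
    by simp
qed

text \<open>Occurrences inside \<open>A\<close> and inside \<open>B\<close> stay occurrences in \<open>A @ B\<close>. They are distinct because
  a nonempty window cannot both end within \<open>A\<close> and start at or after its end.\<close>

lemma multiplicity_append_superadditive:
  assumes "X \<noteq> []"
  shows "multiplicity A X + multiplicity B X \<le> multiplicity (A @ B) X"
proof -
  let ?occ = "\<lambda>S. {(P1, P2). S = P1 @ X @ P2}"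
  let ?left = "(\<lambda>(P1, P2). (P1, P2 @ B)) ` ?occ A"
  let ?right = "(\<lambda>(P1, P2). (A @ P1, P2)) ` ?occ B"
  have "card ?left = multiplicity A X" "card ?right = multiplicity B X"
    unfolding multiplicity_def by (auto intro!: card_image simp: inj_on_def)
  moreover have "?left \<inter> ?right = {}"
    using assms by auto
  then have "card (?left \<union> ?right) = card ?left + card ?right"
    by (intro card_Un_disjoint finite_imageI finite_occurrences)
  moreover have "card (?left \<union> ?right) \<le> multiplicity (A @ B) X"
    unfolding multiplicity_def by (intro card_mono finite_occurrences) auto
  ultimately show ?thesis
    by simp
qed

lemma multiplicity_flanks_le:
  assumes "X \<noteq> []"
  shows "multiplicity P X + multiplicity Q X \<le> multiplicity (P @ C @ Q) X"
  using multiplicity_append_superadditive[OF assms, of P "C @ Q"]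
        multiplicity_append_superadditive[OF assms, of C Q] by simp

text \<open>The total mass outside the common part counts the windows that are contained neither in \<open>P\<close>
  nor in \<open>Q\<close>. Their number is at most \<open>k\<close> when both flanks are long, is capped by the number of starting
  (or ending) positions when a flank is short, and follows from the window counts by truncated
  subtraction.\<close>

lemma sum_multiplicity_remainder_le:
  assumes "finite \<Sigma>" "P \<in> lists \<Sigma>" "C \<in> lists \<Sigma>" "Q \<in> lists \<Sigma>" "length C \<le> 1"
  shows "(\<Sum>X\<in>words \<Sigma> k. real (multiplicity (P @ C @ Q) X)
                            - (real (multiplicity P X) + real (multiplicity Q X)))
           \<le> real (min k (min (length P + 1) (length Q + 1)))"
proof -
  have total: "(\<Sum>X\<in>words \<Sigma> k. real (multiplicity S X)) = real (length S + 1 - k)"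
    if "S \<in> lists \<Sigma>" for S
    using sum_multiplicity_words[OF assms(1) that, of k] by (simp flip: of_nat_sum)
  have "P @ C @ Q \<in> lists \<Sigma>"
    using assms by auto
  then show ?thesis
    using assms by (simp add: sum_subtractf sum.distrib total del: of_nat_add of_nat_diff)
qed

text \<open>Since \<open>c \<le> c\<^sup>2\<close> for a natural number \<open>c\<close>, the square norm dominates the number of windows.\<close>

lemma sqrt_windows_le_L2_set:
  assumes "finite \<Sigma>" "S \<in> lists \<Sigma>"
  shows "sqrt (real (length S + 1 - k)) \<le> L2_set (gram_vec \<Sigma> k S) (words \<Sigma> k)"
  unfolding L2_set_def
proof (rule real_sqrt_le_mono)
  have "real (length S + 1 - k) = (\<Sum>X\<in>words \<Sigma> k. real (multiplicity S X))"
    using sum_multiplicity_words[OF assms, of k] by (simp flip: of_nat_sum)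
  also have "\<dots> \<le> (\<Sum>X\<in>words \<Sigma> k. (gram_vec \<Sigma> k S X)\<^sup>2)"
  proof (rule sum_mono)
    fix X assume "X \<in> words \<Sigma> k"
    moreover have "multiplicity S X \<le> (multiplicity S X)\<^sup>2"
      by (simp add: power2_eq_square)
    then have "real (multiplicity S X) \<le> (real (multiplicity S X))\<^sup>2"
      by (metis of_nat_le_iff of_nat_power)
    ultimately show "real (multiplicity S X) \<le> (gram_vec \<Sigma> k S X)\<^sup>2"
      by (simp add: gram_vec_def)
  qed
  finally show "real (length S + 1 - k) \<le> (\<Sum>X\<in>words \<Sigma> k. (gram_vec \<Sigma> k S X)\<^sup>2)" .
qed

section \<open>The effect of a local replacement on one angle\<close>

lemma gram_vec_nonneg: "X \<in> words \<Sigma> k \<Longrightarrow> 0 \<le> gram_vec \<Sigma> k S X"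
  by (simp add: gram_vec_def)

lemma gram_angle_le_half_pi: "gram_angle \<Sigma> k S T \<le> pi / 2"
  unfolding gram_angle_def by (intro vec_angle_le_half_pi gram_vec_nonneg)

lemma gram_angle_replace_le:
  assumes "finite \<Sigma>" "P \<in> lists \<Sigma>" "Q \<in> lists \<Sigma>"
    and C: "C \<in> lists \<Sigma>" "length C \<le> 1"
    and D: "D \<in> lists \<Sigma>" "length D \<le> 1"
    and L: "L = length P + length Q"
    and k: "1 \<le> k" "k \<le> L div 2"
  shows "gram_angle \<Sigma> k (P @ C @ Q) (P @ D @ Q)
           \<le> pi / sqrt (real L) * real (min k (min (length P + 1) (length Q + 1)))"
proof -
  let ?I = "words \<Sigma> k"
  define t where "t = real (min k (min (length P + 1) (length Q + 1)))"
  define u v where "u = gram_vec \<Sigma> k (P @ C @ Q)" and "v = gram_vec \<Sigma> k (P @ D @ Q)"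
  define w where "w X = real (multiplicity P X) + real (multiplicity Q X)" for X
  have fin: "finite ?I"
    unfolding words_def by (rule finite_lists_length_eq[OF assms(1)])
  have Lpos: "real L > 0"
    using k by auto

  have common: "w X \<le> gram_vec \<Sigma> k (P @ E @ Q) X" if "X \<in> ?I" for X E
  proof -
    have "X \<noteq> []"
      using that k by (auto simp: words_def)
    then show ?thesis
      using multiplicity_flanks_le[of X P Q E] that by (simp add: w_def gram_vec_def)
  qed
  have mass: "(\<Sum>X\<in>?I. gram_vec \<Sigma> k (P @ E @ Q) X - w X) \<le> t"
    if "E \<in> lists \<Sigma>" "length E \<le> 1" for E
    using sum_multiplicity_remainder_le[OF assms(1,2) that(1) assms(3) that(2), of k]
    by (simp add: w_def gram_vec_def t_def)
  have diff: "L2_set (\<lambda>X. u X - v X) ?I \<le> sqrt 2 * t"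
    unfolding u_def v_def by (rule L2_set_diff_le_common_part[OF common common mass[OF C] mass[OF D]])

  \<comment> \<open>At least \<open>L + 1 - K \<ge> L / 2\<close> windows have length \<open>k \<le> K\<close>.\<close>
  have "sqrt (real L / 2) \<le> sqrt (real (length (P @ C @ Q) + 1 - k))"
    using k L by (intro real_sqrt_le_mono) (simp add: of_nat_diff)
  also have "\<dots> \<le> L2_set u ?I"
    unfolding u_def using assms by (intro sqrt_windows_le_L2_set) auto
  finally have norm: "sqrt (real L / 2) \<le> L2_set u ?I" .

  have "\<not> vec_zero ?I u"
  proof
    assume "vec_zero ?I u"
    then have "L2_set u ?I = 0"
      by (intro L2_set_0') (simp add: vec_zero_def)
    then show False
      using norm Lpos by simp
  qed
  then have "gram_angle \<Sigma> k (P @ C @ Q) (P @ D @ Q)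
               \<le> pi / 2 * (L2_set (\<lambda>X. u X - v X) ?I / L2_set u ?I)"
    unfolding gram_angle_def u_def v_def
    by (intro vec_angle_le_relative_error fin gram_vec_nonneg)
  also have "\<dots> \<le> pi / 2 * (sqrt 2 * t / sqrt (real L / 2))"
    using diff norm Lpos by (intro mult_left_mono frac_le) (auto simp: t_def)
  also have "\<dots> = pi / sqrt (real L) * t"
    by (simp add: real_sqrt_divide field_simps)
  finally show ?thesis
    by (simp add: t_def)
qed

section \<open>Summation over the window length\<close>

lemma sums_geometric_tail:
  fixes \<rho> :: real
  assumes "0 < \<rho>" "\<rho> < 1"
  shows "(\<lambda>k. if N \<le> k then \<rho> ^ Suc k else 0) sums (\<rho> ^ (N + 1) / (1 - \<rho>))"
proof -
  have "(\<lambda>k. \<rho> ^ (N + 1) * \<rho> ^ k) sums (\<rho> ^ (N + 1) * (1 / (1 - \<rho>)))"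
    using assms by (intro sums_mult geometric_sums) simp
  then have "(\<lambda>k. if N \<le> k + N then \<rho> ^ Suc (k + N) else 0) sums (\<rho> ^ (N + 1) / (1 - \<rho>))"
    by (simp add: power_add mult_ac)
  moreover have "(\<Sum>k<N. if N \<le> k then \<rho> ^ Suc k else 0) = 0"
    by (intro sum.neutral) auto
  ultimately show ?thesis
    using sums_iff_shift[of "\<lambda>k. if N \<le> k then \<rho> ^ Suc k else 0" N] by simp
qed

text \<open>Raising the cap from \<open>M\<close> to \<open>M + 1\<close> adds one to the coefficients of \<open>\<rho>\<^sup>k\<close> with \<open>k > M\<close>, that is,
  the geometric tail \<open>\<rho>\<^sup>M\<^sup>+\<^sup>1 / (1 - \<rho>)\<close>.\<close>

lemma sums_power_mult_min:
  fixes \<rho> :: real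
  assumes "0 < \<rho>" "\<rho> < 1"
  shows "(\<lambda>k. \<rho> ^ Suc k * real (min (Suc k) M)) sums (\<rho> * (1 - \<rho> ^ M) / (1 - \<rho>)\<^sup>2)"
proof (induction M)
  case 0
  then show ?case
    by simp
next
  case (Suc M)
  have "(\<lambda>k. \<rho> ^ Suc k * real (min (Suc k) M) + (if M \<le> k then \<rho> ^ Suc k else 0))
          sums (\<rho> * (1 - \<rho> ^ M) / (1 - \<rho>)\<^sup>2 + \<rho> ^ (M + 1) / (1 - \<rho>))"
    by (intro sums_add Suc.IH sums_geometric_tail assms)
  moreover have "\<rho> ^ Suc k * real (min (Suc k) M) + (if M \<le> k then \<rho> ^ Suc k else 0)
                   = \<rho> ^ Suc k * real (min (Suc k) (Suc M))" for k
    by (auto simp: min_def algebra_simps not_le less_Suc_eq_le antisym)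
  moreover have "\<rho> * (1 - \<rho> ^ M) / (1 - \<rho>)\<^sup>2 + \<rho> ^ (M + 1) / (1 - \<rho>)
                   = \<rho> * (1 - \<rho> ^ Suc M) / (1 - \<rho>)\<^sup>2"
    using assms by (simp add: divide_simps) (simp add: power2_eq_square algebra_simps)
  ultimately show ?case
    by simp
qed

lemma A_series_closed_form:
  assumes "0 < \<rho>" "\<rho> < 1"
  shows "A_series M \<rho>
           = \<rho> * (1 - real (M + 1) * \<rho> ^ M + real M * \<rho> ^ (M + 1)) / (1 - \<rho>)\<^sup>2
              + real M * \<rho> ^ (M + 1) / (1 - \<rho>)"
proof -
  have "A_series M \<rho> = \<rho> * (1 - \<rho> ^ M) / (1 - \<rho>)\<^sup>2"
    unfolding A_series_def by (rule sums_unique[symmetric, OF sums_power_mult_min[OF assms]])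
  also have "\<dots> = \<rho> * (1 - real (M + 1) * \<rho> ^ M + real M * \<rho> ^ (M + 1)) / (1 - \<rho>)\<^sup>2
                    + real M * \<rho> ^ (M + 1) / (1 - \<rho>)"
    using assms by (simp add: divide_simps) (simp add: power2_eq_square algebra_simps)
  finally show ?thesis .
qed

lemma A_series_nonneg:
  assumes "0 < \<rho>" "\<rho> < 1"
  shows "0 \<le> A_series M \<rho>"
  unfolding A_series_def using assms by (intro suminf_nonneg summable_A_series) auto

text \<open>
  The sum is split at \<open>k = K\<close>. Below, the angle estimate applies; there \<open>L > 0\<close> holds automatically.
  Above, the angle is at most \<open>\<pi>/2\<close>. Extending the first part to all \<open>k\<close> gives the whole of
  \<open>A_series\<close>.
\<close>

lemma gram_dist_replace_le:
  assumes "finite \<Sigma>" and \<rho>: "0 < \<rho>" "\<rho> < 1"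
    and "P \<in> lists \<Sigma>" "Q \<in> lists \<Sigma>"
    and "C \<in> lists \<Sigma>" "length C \<le> 1" "D \<in> lists \<Sigma>" "length D \<le> 1"
    and L: "L = length P + length Q"
  shows "gram_dist \<Sigma> \<rho> (P @ C @ Q) (P @ D @ Q)
           \<le> pi / sqrt (real L) * A_series (min (length P + 1) (length Q + 1)) \<rho>
              + pi / 2 * (\<rho> ^ (L div 2 + 1) / (1 - \<rho>))"
proof -
  define M where "M = min (length P + 1) (length Q + 1)"
  define main tail where "main k = \<rho> ^ Suc k * real (min (Suc k) M)"
    and "tail k = (if L div 2 \<le> k then \<rho> ^ Suc k else 0)" for k
  have bound: "\<rho> ^ Suc k * gram_angle \<Sigma> (Suc k) (P @ C @ Q) (P @ D @ Q)
                 \<le> pi / sqrt (real L) * main k + pi / 2 * tail k" for k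
  proof (cases "L div 2 \<le> k")
    case True
    have "\<rho> ^ Suc k * gram_angle \<Sigma> (Suc k) (P @ C @ Q) (P @ D @ Q) \<le> \<rho> ^ Suc k * (pi / 2)"
      using \<rho> by (intro mult_left_mono gram_angle_le_half_pi) auto
    moreover have "0 \<le> pi / sqrt (real L) * main k"
      using \<rho> by (simp add: main_def)
    ultimately show ?thesis
      using True by (simp add: tail_def mult.commute)
  next
    case False
    have "gram_angle \<Sigma> (Suc k) (P @ C @ Q) (P @ D @ Q)
            \<le> pi / sqrt (real L) * real (min (Suc k) M)"
      unfolding M_def using assms False by (intro gram_angle_replace_le) auto
    then have "\<rho> ^ Suc k * gram_angle \<Sigma> (Suc k) (P @ C @ Q) (P @ D @ Q)
                 \<le> \<rho> ^ Suc k * (pi / sqrt (real L) * real (min (Suc k) M))"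
      using \<rho> by (intro mult_left_mono) auto
    then show ?thesis
      using False by (simp add: tail_def main_def mult_ac)
  qed
  have "main sums A_series M \<rho>"
    unfolding main_def A_series_def by (rule summable_sums[OF summable_A_series[OF \<rho>]])
  moreover have "tail sums (\<rho> ^ (L div 2 + 1) / (1 - \<rho>))"
    unfolding tail_def by (rule sums_geometric_tail[OF \<rho>])
  ultimately have "(\<lambda>k. pi / sqrt (real L) * main k + pi / 2 * tail k) sums
      (pi / sqrt (real L) * A_series M \<rho> + pi / 2 * (\<rho> ^ (L div 2 + 1) / (1 - \<rho>)))"
    by (intro sums_add sums_mult)
  then show ?thesis
    unfolding gram_dist_def M_def[symmetric]
    by (rule sums_le[OF bound summable_sums[OF summable_gram_dist]])
qed

section \<open>Insertion and substitution of one letter\<close>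

theorem theorem7p3:
  fixes \<Sigma> :: "'a set" and \<rho> :: real and P Q :: "'a list" and a b :: 'a
    and m n L K M :: nat
  assumes "finite \<Sigma>"
    and "0 < \<rho>" and "\<rho> < 1"
    and "P \<in> lists \<Sigma>" and "Q \<in> lists \<Sigma>"
    and "length P = m" and "length Q = n"
    and "a \<in> \<Sigma>" and "b \<in> \<Sigma>"
    and "L = m + n" and "K = L div 2" and "M = min (m + 1) (n + 1)"
  shows "gram_dist \<Sigma> \<rho> (P @ [a] @ Q) (P @ Q)
           \<le> pi * sqrt 2 / sqrt (real L) * A_series M \<rho>
              + pi / 2 * (\<rho> ^ (K + 1) / (1 - \<rho>)) + pi / 2 * \<rho> ^ (L + 1)
       \<and> gram_dist \<Sigma> \<rho> (P @ [a] @ Q) (P @ [b] @ Q)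
           \<le> pi / sqrt (real L) * A_series M \<rho>
              + pi / 2 * (\<rho> ^ (K + 1) / (1 - \<rho>))
       \<and> A_series M \<rho>
           = \<rho> * (1 - real (M + 1) * \<rho> ^ M + real M * \<rho> ^ (M + 1)) / (1 - \<rho>)\<^sup>2
              + real M * \<rho> ^ (M + 1) / (1 - \<rho>)"
proof (intro conjI)
  note len = \<open>length P = m\<close> \<open>length Q = n\<close>
  have a: "[a] \<in> lists \<Sigma>" and b: "[b] \<in> lists \<Sigma>"
    using assms by auto
  have bound: "gram_dist \<Sigma> \<rho> (P @ [a] @ Q) (P @ D @ Q)
                 \<le> pi / sqrt (real L) * A_series M \<rho> + pi / 2 * (\<rho> ^ (K + 1) / (1 - \<rho>))"
    if "D \<in> lists \<Sigma>" "length D \<le> 1" for D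
    using gram_dist_replace_le[OF assms(1-5) a _ that, of L] assms by simp
  show "gram_dist \<Sigma> \<rho> (P @ [a] @ Q) (P @ [b] @ Q)
          \<le> pi / sqrt (real L) * A_series M \<rho> + pi / 2 * (\<rho> ^ (K + 1) / (1 - \<rho>))"
    using bound[OF b] by simp
  have "pi / sqrt (real L) * A_series M \<rho> \<le> pi * sqrt 2 / sqrt (real L) * A_series M \<rho>"
    using A_series_nonneg[OF assms(2,3)]
    by (intro mult_right_mono divide_right_mono) auto
  moreover have "0 \<le> pi / 2 * \<rho> ^ (L + 1)"
    using assms by simp
  moreover have "gram_dist \<Sigma> \<rho> (P @ [a] @ Q) (P @ Q)
      \<le> pi / sqrt (real L) * A_series M \<rho> + pi / 2 * (\<rho> ^ (K + 1) / (1 - \<rho>))"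
    using bound[of "[]"] by simp
  ultimately show "gram_dist \<Sigma> \<rho> (P @ [a] @ Q) (P @ Q)
      \<le> pi * sqrt 2 / sqrt (real L) * A_series M \<rho>
         + pi / 2 * (\<rho> ^ (K + 1) / (1 - \<rho>)) + pi / 2 * \<rho> ^ (L + 1)"
    by linarith
qed (rule A_series_closed_form[OF assms(2,3)])

end
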